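(* Let $D\subseteq\mathbb{R}$ be a nonempty compact set, let $a>0$, $0\le b_{\min}<b_{\max}$, $k_1,k_2\in\mathbb{R}$ be constants, and let $f:D\times[0,a]\to\mathbb{R}$ be continuous with $0\le f(d,x)\le x$ for all $(d,x)\in D\times[0,a]$. Let $P(s):=\max(b_{\min},\min(s,b_{\max}))$ for $s\in\mathbb{R}$. Assume that $(x^*,u^*,v^* )\in(0,a)\times(b_{\min},b_{\max})\times[0,+\infty)$ satisfies $f(d,x^* )=u^*+v^*<a-x^*$ for all $d\in D$, and that $$x^*+v^*+b_{\max}<a .$$ Assume moreover that there are constants $r\le \dfrac{b_{\min}-u^*}{a-v^*-x^*-b_{\max}}$ with $0<k_1+k_2+r<2$, $\lambda_i\in[0,1)$, $\gamma_i\in(0,1-\lambda_i)$ ($i=1,2$), $L\in[0,1)$, $q\in(0,1]$, $M\in(1,+\infty)$ such that, with $\beta:=k_1+k_2+r$, the following inequalities hold. (a) For all $(d,x)\in D\times[a-v^*-b_{\max},a]$: $$-\frac{k_1+LM^{-1}}{\beta+M^{-1}}(x-x^* )+\frac{L b_{\min}+u^*-(1+L)\max(b_{\min},a-v^*-x)}{\beta+M^{-1}}\le f(d,x)+x^*-a\le 0 .$$ (b) For all $(d,x)\in D\times[a-v^*-b_{\max},a]$: $$\big(f(d,x)+x^*-a\big)\big(\beta-M^{-1}\big)\le \big(LM^{-1}-k_1\big)(x-x^* )+u^*-L b_{\min}-(1-L)b_{\max}.$$ (c) For all $(d,x)\in D\times[x^*,a-v^*-b_{\min}]$: $$-(\lambda_1q^{-1}+1)(x-x^*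 )\le P\big(u^*+r(x-x^* )\big)-f(d,x)+v^*\le(\lambda_1-1)(x-x^* ).$$ (d) For all $(d,x)\in D\times[x^*,a-v^*-b_{\min}]$: $$\big|(1-\beta)P(u^*+r(x-x^* ))+\beta f(d,x)-\beta v^*-(\beta-k_1)(x-x^* )-u^*\big|\le\gamma_1(x-x^* ).$$ (e) For all $(d,x)\in D\times[0,x^*]$: $$(\lambda_2-1)(x-x^* )\le P\big(u^*+r(x-x^* )\big)-f(d,x)+v^*\le-(\lambda_2q+1)(x-x^* ).$$ (f) For all $(d,x)\in D\times[0,x^*]$: $$\big|(1-\beta)P(u^*+r(x-x^* ))+\beta f(d,x)-\beta v^*-(\beta-k_1)(x-x^* )-u^*\big|\le\gamma_2 q|x-x^*|.$$ Finally suppose that $$1+\min_{i=1,2}\Big(\frac{1-\lambda_i}{\gamma_i}\Big)|1-\beta|<\min_{i=1,2}\Big(\frac{1-\lambda_i}{\gamma_i}\Big),\qquad \frac{1}{1-|1-\beta|}<M<\min_{i=1,2}\Big(\frac{1-\lambda_i}{\gamma_i}\Big).$$ Then for all sequences $\{d(i)\in D\}_{i=0}^\infty$ and $\{v(i)\in[0,+\infty)\}_{i=0}^\infty$ and every initial condition $(x(0),y(0),w(0))\in[0,a]^2\times\mathbb{R}$, the corresponding solution of the closed-loop system (defined in the context) satisfies, for all $t\ge1$, $$\max\big(q(x^*-x(t)),\,x(t)-x^*\big)\le \lambda^tM(1+|r|+|k_1|+|k_2|)\big(|x(0)-x^*|+|y(0)-x^*|+|w(0)-u^*|\big)+\frac{\gamma}{1-\lambda}\max_{i=0,\ldots,t-1}|v(i)-v^*|,$$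 where $\lambda:=\max\big(M^{-1}+|1-\beta|,\,L,\,\max_{i=1,2}(\lambda_i+M\gamma_i)\big)$ and $\gamma:=1+M|k_1+k_2|+M|r|$.
   Context: The closed-loop system is the discrete-time system on the state space $[0,a]^2\times\mathbb{R}$ with inputs $d(t)\in D$, $v(t)\in[0,+\infty)$ given for $t=0,1,2,\ldots$ by $$x(t+1)=x(t)-f(d(t),x(t))+\min\big(u(t)+v(t),\,a-x(t)\big),\quad y(t+1)=x(t),\quad w(t+1)=u(t),$$ $$u(t)=\max\big(b_{\min},\min(w(t)-k_1(x(t)-y(t))-k_2(x(t)-x^* ),\,b_{\max})\big).$$ *)

theory Defs
  imports "HOL-Analysis.Analysis"
begin

definition sat :: "real \<Rightarrow> real \<Rightarrow> real \<Rightarrow> real" where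
  "sat bmin bmax s = max bmin (min s bmax)"

definition feedback ::
  "real \<Rightarrow> real \<Rightarrow> real \<Rightarrow> real \<Rightarrow> real \<Rightarrow> real \<Rightarrow> real \<Rightarrow> real \<Rightarrow> real" where
  "feedback bmin bmax k1 k2 xs x y w =
     sat bmin bmax (w - k1 * (x - y) - k2 * (x - xs))"

(* The plant function f is total here, but for an initial state in [0,a]^2 x R and
   admissible inputs only its values on D x [0,a] matter: 0 <= f d x <= x and bmin >= 0
   keep x and y in [0,a]. *)
definition closed_loop_solution ::
  "(real \<Rightarrow> real \<Rightarrow> real) \<Rightarrow> real \<Rightarrow> real \<Rightarrow> real \<Rightarrow> real \<Rightarrow> real \<Rightarrow> real \<Rightarrow>
   (nat \<Rightarrow> real) \<Rightarrow> (nat \<Rightarrow> real) \<Rightarrow>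
   (nat \<Rightarrow> real) \<Rightarrow> (nat \<Rightarrow> real) \<Rightarrow> (nat \<Rightarrow> real) \<Rightarrow> bool" where
  "closed_loop_solution f a bmin bmax k1 k2 xs d v x y w \<longleftrightarrow>
     (\<forall>t. let u = feedback bmin bmax k1 k2 xs (x t) (y t) (w t) in
        x (Suc t) = x t - f (d t) (x t) + min (u + v t) (a - x t) \<and>
        y (Suc t) = x t \<and>
        w (Suc t) = u)"

end

theory Submission
  imports Defs
begin

(* With X = x - xs, let z = w - k1 (x - y) - k2 X - us - r X be the distance of the unsaturated
   control from the line us + r X. The Lyapunov function is V = max (- q X) X + M |z|, and
   V(t+1) <= lam V(t) + gam |v(t) - vs|. If x <= a - vs - u, the minimum in the plant equation only
   replaces v by some v' that is no further from vs, and (c)-(f) bound the two summands of V(t+1)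
   separately. If x > a - vs - u, then us + r X <= bmin, so |z| >= u - bmin; up to an error
   controlled by |v - vs| the next state is a - f, and (a), (b) are the two signs
   of z(t+1) in V(t+1) <= L V(t). *)

text \<open>The left side of the claimed estimate is this gauge applied to x - xs. As a maximum of
  two linear functions it is bounded above by proving two linear inequalities, and these are the two
  sides of (c) and of (e).\<close>

definition asym_norm :: "real \<Rightarrow> real \<Rightarrow> real" where
  "asym_norm q X = max (q * (- X)) X"

lemma asym_norm_ge: "q * (- X) \<le> asym_norm q X" "X \<le> asym_norm q X"
  by (auto simp: asym_norm_def)

lemma asym_norm_le_abs:
  assumes "0 < q" "q \<le> 1"
  shows "asym_norm q X \<le> \<bar>X\<bar>"
proof -
  have "q * (- X) \<le> \<bar>q * (- X)\<bar>" by simp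
  also have "\<dots> \<le> 1 * \<bar>X\<bar>"
    unfolding abs_mult abs_minus_cancel using assms by (intro mult_right_mono) auto
  finally show ?thesis by (simp add: asym_norm_def)
qed

lemma asym_norm_add_le:
  assumes "0 < q" "q \<le> 1"
  shows "asym_norm q (X + e) \<le> asym_norm q X + \<bar>e\<bar>"
  using asym_norm_le_abs[OF assms, of e] by (auto simp: asym_norm_def algebra_simps)

lemma sat_lipschitz: "\<bar>sat bmin bmax (s + z) - sat bmin bmax s\<bar> \<le> \<bar>z\<bar>"
  by (auto simp: sat_def max_def min_def)

text \<open>\<open>P\<close> stands for the saturated value of us + r X. Then
  \<open>X + (P - F + vs)\<close> is the next deviation under the nominal inputs \<open>P\<close>
  and \<open>vs\<close>, and the expression in \<open>resid\<close> is the next z under them.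
  Passing to \<open>u\<close> and \<open>v'\<close> adds \<open>(u - P) + (v' - vs)\<close> to the
  deviation and \<open>(1 - beta) * (u - P) - beta * (v' - vs)\<close> to z.\<close>

lemma unsaturated_step:
  fixes X F P u v' z :: real
  assumes "0 < q" "q \<le> 1" "0 < M" "0 < beta"
    and upper: "X + (P - F + vs) \<le> l * asym_norm q X"
    and lower: "q * (- (X + (P - F + vs))) \<le> l * asym_norm q X"
    and resid: "\<bar>(1 - beta) * P + beta * F - beta * vs - (beta - k1) * X - us\<bar> \<le> g * asym_norm q X"
    and uP: "\<bar>u - P\<bar> \<le> \<bar>z\<bar>"
  shows "asym_norm q (X - F + (u + v')) + M * \<bar>u + k1 * X - beta * (X - F + (u + v')) - us\<bar>
    \<le> (l + M * g) * asym_norm q X + (inverse M + \<bar>1 - beta\<bar>) * (M * \<bar>z\<bar>) + (1 + M * beta) * \<bar>v' - vs\<bar>"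
proof -
  have "asym_norm q (X - F + (u + v')) = asym_norm q ((X + (P - F + vs)) + ((u - P) + (v' - vs)))"
    by (simp add: algebra_simps)
  also have "\<dots> \<le> asym_norm q (X + (P - F + vs)) + \<bar>(u - P) + (v' - vs)\<bar>"
    using assms by (intro asym_norm_add_le)
  also have "\<dots> \<le> l * asym_norm q X + (\<bar>z\<bar> + \<bar>v' - vs\<bar>)"
    using upper lower uP by (intro add_mono) (auto simp: asym_norm_def)
  finally have 1: "asym_norm q (X - F + (u + v')) \<le> l * asym_norm q X + (\<bar>z\<bar> + \<bar>v' - vs\<bar>)" .
  have "\<bar>(1 - beta) * (u - P)\<bar> \<le> \<bar>1 - beta\<bar> * \<bar>z\<bar>"
    unfolding abs_mult using uP by (intro mult_left_mono) auto
  moreover have "\<bar>beta * (v' - vs)\<bar> = beta * \<bar>v' - vs\<bar>"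
    using assms by (simp add: abs_mult)
  moreover have "u + k1 * X - beta * (X - F + (u + v')) - us =
      ((1 - beta) * P + beta * F - beta * vs - (beta - k1) * X - us)
      + (1 - beta) * (u - P) - beta * (v' - vs)"
    by (simp add: algebra_simps)
  ultimately have "\<bar>u + k1 * X - beta * (X - F + (u + v')) - us\<bar>
      \<le> g * asym_norm q X + \<bar>1 - beta\<bar> * \<bar>z\<bar> + beta * \<bar>v' - vs\<bar>"
    using resid by linarith
  then have "M * \<bar>u + k1 * X - beta * (X - F + (u + v')) - us\<bar>
      \<le> M * (g * asym_norm q X + \<bar>1 - beta\<bar> * \<bar>z\<bar> + beta * \<bar>v' - vs\<bar>)"
    using assms by (intro mult_left_mono) auto
  \<comment> \<open>The share of |z| that comes from the deviation is \<open>inverse M\<close> times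
    the summand M |z| of the Lyapunov function.\<close>
  moreover have "(inverse M + \<bar>1 - beta\<bar>) * (M * \<bar>z\<bar>) = \<bar>z\<bar> + M * (\<bar>1 - beta\<bar> * \<bar>z\<bar>)"
    using \<open>0 < M\<close> by (simp add: distrib_right)
  ultimately show ?thesis
    using 1 by (simp only: distrib_left distrib_right mult_1 mult.assoc)
qed

text \<open>\<open>F\<close> stands for f + xs - a, so \<open>- F\<close> is the next deviation when
  the inputs exactly fill the remaining capacity a - x, and \<open>e\<close> is the error of that
  description. Write z' for \<open>u + k1 * X + beta * F - us\<close>, the next z at e = 0.
  Multiplying \<open>upper\<close> by M and \<open>lower\<close> by M (beta + 1/M) bounds - F + M z'
  and - F - M z' by the same quantity L (X + M (u - bmin)), hence also - F + M |z'|.\<close>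

lemma saturated_step:
  fixes X F u z e :: real
  assumes "0 < q" "q \<le> 1" "0 < M" "0 < beta" "0 \<le> L"
    and F: "F \<le> 0"
    and lower: "- ((k1 + L * inverse M) / (beta + inverse M)) * X
      + (L * bmin + us - (1 + L) * u) / (beta + inverse M) \<le> F"
    and upper: "F * (beta - inverse M) \<le> (L * inverse M - k1) * X + us - L * bmin - (1 - L) * u"
    and u: "u - bmin \<le> \<bar>z\<bar>"
  shows "asym_norm q (- F + e) + M * \<bar>u + k1 * X - beta * (- F + e) - us\<bar>
    \<le> L * (asym_norm q X + M * \<bar>z\<bar>) + (1 + M * beta) * \<bar>e\<bar>"
proof -
  have "q * F \<le> 0"
    using assms by (simp add: mult_nonneg_nonpos)
  then have "asym_norm q (- F) = - F"
    using F by (simp add: asym_norm_def)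
  then have norm_bound: "asym_norm q (- F + e) \<le> - F + \<bar>e\<bar>"
    using asym_norm_add_le[of q "- F" e] assms by simp
  have Minv: "M * inverse M = 1" "M * (c * inverse M) = c" for c
    using \<open>0 < M\<close> by simp_all
  have "M * (F * (beta - inverse M))
      \<le> M * ((L * inverse M - k1) * X + us - L * bmin - (1 - L) * u)"
    using upper assms by (intro mult_left_mono) auto
  then have pos: "- F + M * (u + k1 * X + beta * F - us) \<le> L * (X + M * (u - bmin))"
    by (simp add: algebra_simps Minv)
  have beta': "beta + inverse M > 0"
    using assms by (simp add: add_pos_pos)
  have "(beta + inverse M) * (- ((k1 + L * inverse M) / (beta + inverse M)) * X
      + (L * bmin + us - (1 + L) * u) / (beta + inverse M)) \<le> (beta + inverse M) * F"
    using lower beta' by (intro mult_left_mono) auto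
  moreover have "(beta + inverse M) * (- ((k1 + L * inverse M) / (beta + inverse M)) * X
      + (L * bmin + us - (1 + L) * u) / (beta + inverse M))
      = - (k1 + L * inverse M) * X + (L * bmin + us - (1 + L) * u)"
    unfolding distrib_left[of "beta + inverse M"] using beta' by (simp add: divide_simps)
  ultimately have "- (k1 + L * inverse M) * X + (L * bmin + us - (1 + L) * u)
      \<le> (beta + inverse M) * F" by simp
  then have "M * (- (k1 + L * inverse M) * X + (L * bmin + us - (1 + L) * u))
      \<le> M * ((beta + inverse M) * F)"
    using assms by (intro mult_left_mono) auto
  then have neg: "- F - M * (u + k1 * X + beta * F - us) \<le> L * (X + M * (u - bmin))"
    by (simp add: algebra_simps Minv)
  have "- F + M * \<bar>u + k1 * X + beta * F - us\<bar> \<le> L * (X + M * (u - bmin))"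
  proof -
    have "M * \<bar>u + k1 * X + beta * F - us\<bar> = \<bar>M * (u + k1 * X + beta * F - us)\<bar>"
      using \<open>0 < M\<close> by (simp add: abs_mult)
    then show ?thesis using pos neg by linarith
  qed
  also have "\<dots> \<le> L * (asym_norm q X + M * \<bar>z\<bar>)"
    using assms asym_norm_ge(2)[of X q] by (intro mult_left_mono add_mono) auto
  finally have main: "- F + M * \<bar>u + k1 * X + beta * F - us\<bar> \<le> L * (asym_norm q X + M * \<bar>z\<bar>)" .
  have "\<bar>beta * e\<bar> = beta * \<bar>e\<bar>"
    using assms by (simp add: abs_mult)
  moreover have "u + k1 * X - beta * (- F + e) - us = (u + k1 * X + beta * F - us) - beta * e"
    by (simp add: algebra_simps)
  ultimately have "\<bar>u + k1 * X - beta * (- F + e) - us\<bar>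
      \<le> \<bar>u + k1 * X + beta * F - us\<bar> + beta * \<bar>e\<bar>"
    by linarith
  then have "M * \<bar>u + k1 * X - beta * (- F + e) - us\<bar>
      \<le> M * (\<bar>u + k1 * X + beta * F - us\<bar> + beta * \<bar>e\<bar>)"
    using assms by (intro mult_left_mono) auto
  then show ?thesis
    using norm_bound main by (simp add: algebra_simps)
qed

lemma linear_recursion_bound:
  fixes V e :: "nat \<Rightarrow> real"
  assumes lam: "0 \<le> lam" "lam < 1" and c: "0 \<le> c"
    and step: "\<And>t. V (Suc t) \<le> lam * V t + c * e t"
    and e: "\<And>t. t < n \<Longrightarrow> e t \<le> B" and B: "0 \<le> B"
  shows "V n \<le> lam ^ n * V 0 + c / (1 - lam) * B"
  using e
proof (induction n)
  case 0
  then show ?case using assms by simp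
next
  case (Suc n)
  have "V (Suc n) \<le> lam * V n + c * e n" by (rule step)
  also have "\<dots> \<le> lam * (lam ^ n * V 0 + c / (1 - lam) * B) + c * B"
    using Suc lam c by (intro add_mono mult_left_mono) auto
  also have "\<dots> = lam ^ Suc n * V 0 + c / (1 - lam) * B"
  proof -
    \<comment> \<open>\<open>K\<close> is the fixed point of the map K -> lam K + c, so the constant
      part of the bound reproduces itself.\<close>
    define K where "K = c / (1 - lam)"
    have "(1 - lam) * K = c"
      using lam by (simp add: K_def)
    then have c_eq: "c = K - lam * K"
      by (simp add: left_diff_distrib)
    show ?thesis
      unfolding K_def[symmetric] unfolding c_eq by (simp add: algebra_simps)
  qed
  finally show ?case .
qed

theorem theorem3p2:
  fixes D :: "real set"
    and f :: "real \<Rightarrow> real \<Rightarrow> real"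
    and a bmin bmax k1 k2 xs us vs r lam1 lam2 gam1 gam2 L q M beta lam gam :: real
    and d v x y w :: "nat \<Rightarrow> real"
  assumes D: "compact D" "D \<noteq> {}"
    and bounds: "a > 0" "0 \<le> bmin" "bmin < bmax"
    and f_cont: "continuous_on (D \<times> {0..a}) (\<lambda>(d, x). f d x)"
    and f_bounds: "\<forall>d\<in>D. \<forall>x\<in>{0..a}. 0 \<le> f d x \<and> f d x \<le> x"
    and equil_range: "xs \<in> {0<..<a}" "us \<in> {bmin<..<bmax}" "vs \<ge> 0"
    and equil: "\<forall>d\<in>D. f d xs = us + vs \<and> us + vs < a - xs"
    and room: "xs + vs + bmax < a"
    and r: "r \<le> (bmin - us) / (a - vs - xs - bmax)"
    and beta: "beta = k1 + k2 + r" "0 < beta" "beta < 2"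
    and lam1: "0 \<le> lam1" "lam1 < 1" and lam2: "0 \<le> lam2" "lam2 < 1"
    and gam1: "0 < gam1" "gam1 < 1 - lam1" and gam2: "0 < gam2" "gam2 < 1 - lam2"
    and L: "0 \<le> L" "L < 1" and q: "0 < q" "q \<le> 1" and M: "1 < M"
    and cond_a: "\<forall>d\<in>D. \<forall>x\<in>{a - vs - bmax..a}.
        - ((k1 + L * inverse M) / (beta + inverse M)) * (x - xs)
          + (L * bmin + us - (1 + L) * max bmin (a - vs - x)) / (beta + inverse M)
          \<le> f d x + xs - a
        \<and> f d x + xs - a \<le> 0"
    and cond_b: "\<forall>d\<in>D. \<forall>x\<in>{a - vs - bmax..a}.
        (f d x + xs - a) * (beta - inverse M)
          \<le> (L * inverse M - k1) * (x - xs) + us - L * bmin - (1 - L) * bmax"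
    and cond_c: "\<forall>d\<in>D. \<forall>x\<in>{xs..a - vs - bmin}.
        - (lam1 * inverse q + 1) * (x - xs)
          \<le> sat bmin bmax (us + r * (x - xs)) - f d x + vs
        \<and> sat bmin bmax (us + r * (x - xs)) - f d x + vs \<le> (lam1 - 1) * (x - xs)"
    and cond_d: "\<forall>d\<in>D. \<forall>x\<in>{xs..a - vs - bmin}.
        \<bar>(1 - beta) * sat bmin bmax (us + r * (x - xs)) + beta * f d x
          - beta * vs - (beta - k1) * (x - xs) - us\<bar> \<le> gam1 * (x - xs)"
    and cond_e: "\<forall>d\<in>D. \<forall>x\<in>{0..xs}.
        (lam2 - 1) * (x - xs) \<le> sat bmin bmax (us + r * (x - xs)) - f d x + vs
        \<and> sat bmin bmax (us + r * (x - xs)) - f d x + vs \<le> - (lam2 * q + 1) * (x - xs)"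
    and cond_f: "\<forall>d\<in>D. \<forall>x\<in>{0..xs}.
        \<bar>(1 - beta) * sat bmin bmax (us + r * (x - xs)) + beta * f d x
          - beta * vs - (beta - k1) * (x - xs) - us\<bar> \<le> gam2 * q * \<bar>x - xs\<bar>"
    and small_gain:
      "1 + min ((1 - lam1) / gam1) ((1 - lam2) / gam2) * \<bar>1 - beta\<bar>
         < min ((1 - lam1) / gam1) ((1 - lam2) / gam2)"
    and M_bounds: "1 / (1 - \<bar>1 - beta\<bar>) < M"
      "M < min ((1 - lam1) / gam1) ((1 - lam2) / gam2)"
    and lam: "lam = max (inverse M + \<bar>1 - beta\<bar>)
        (max L (max (lam1 + M * gam1) (lam2 + M * gam2)))"
    and gam: "gam = 1 + M * \<bar>k1 + k2\<bar> + M * \<bar>r\<bar>"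
    and inputs: "\<forall>t. d t \<in> D" "\<forall>t. v t \<ge> 0"
    and init: "x 0 \<in> {0..a}" "y 0 \<in> {0..a}"
    and sol: "closed_loop_solution f a bmin bmax k1 k2 xs d v x y w"
  shows "\<forall>t\<ge>1. max (q * (xs - x t)) (x t - xs)
      \<le> lam ^ t * M * (1 + \<bar>r\<bar> + \<bar>k1\<bar> + \<bar>k2\<bar>)
            * (\<bar>x 0 - xs\<bar> + \<bar>y 0 - xs\<bar> + \<bar>w 0 - us\<bar>)
          + gam / (1 - lam) * Max ((\<lambda>i. \<bar>v i - vs\<bar>) ` {0..t - 1})"
proof -

  \<comment> \<open>Error coordinates and invariance of the state interval\<close>
  define u where "u t = feedback bmin bmax k1 k2 xs (x t) (y t) (w t)" for t
  define X where "X t = x t - xs" for t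
  define s where "s t = w t - k1 * (x t - y t) - k2 * X t" for t
  define z where "z t = s t - us - r * X t" for t
  define V where "V t = asym_norm q (X t) + M * \<bar>z t\<bar>" for t
  have xS: "x (Suc t) = x t - f (d t) (x t) + min (u t + v t) (a - x t)"
    and yS: "y (Suc t) = x t" and wS: "w (Suc t) = u t" for t
    using sol unfolding closed_loop_solution_def Let_def u_def by auto
  \<comment> \<open>Splitting the argument into the line and z prepares for
    \<open>sat_lipschitz\<close>.\<close>
  have u_sat: "u t = sat bmin bmax ((us + r * X t) + z t)" for t
  proof -
    have "(us + r * X t) + z t = w t - k1 * (x t - y t) - k2 * (x t - xs)"
      by (simp add: z_def s_def X_def)
    then show ?thesis by (simp only: u_def feedback_def)
  qed
  have u_range: "bmin \<le> u t" "u t \<le> bmax" for t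
    using bounds by (auto simp: u_sat sat_def)
  \<comment> \<open>Since y(t+1) = x(t) and w(t+1) = u(t), the next deviation enters with total
    coefficient - (k1 + k2 + r) = - beta.\<close>
  have zS: "z (Suc t) = u t + k1 * X t - beta * X (Suc t) - us" for t
    unfolding z_def s_def yS wS X_def beta(1) by (simp add: algebra_simps)
  have dD: "d t \<in> D" and v0: "0 \<le> v t" for t
    using inputs by auto
  have x_range: "x t \<in> {0..a}" for t
  proof (induction t)
    case 0
    then show ?case using init by simp
  next
    case (Suc t)
    have "0 \<le> f (d t) (x t)" "f (d t) (x t) \<le> x t"
      using f_bounds dD Suc by blast+
    moreover have "0 \<le> min (u t + v t) (a - x t)"
      using u_range[of t] v0[of t] bounds Suc by auto
    moreover have "min (u t + v t) (a - x t) \<le> a - x t" by simp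
    ultimately show ?case unfolding xS by auto
  qed

  \<comment> \<open>The contraction rate and the gain\<close>
  have M0: "0 < M" using M by simp
  have beta_lt: "\<bar>1 - beta\<bar> < 1" using beta by auto
  have lam_ge: "inverse M + \<bar>1 - beta\<bar> \<le> lam" "L \<le> lam"
      "lam1 + M * gam1 \<le> lam" "lam2 + M * gam2 \<le> lam"
    unfolding lam by auto
  have lam_nonneg: "0 \<le> lam" using lam_ge L by simp
  \<comment> \<open>The lower end of the window for M makes 1/M + |1 - beta| less than 1; the upper
    end does the same for lam_i + M gam_i.\<close>
  have lam_less: "lam < 1"
  proof -
    have "1 < M * (1 - \<bar>1 - beta\<bar>)"
      using M_bounds(1) beta_lt by (simp add: divide_simps)
    then have "inverse M < 1 - \<bar>1 - beta\<bar>"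
      using M0 by (simp add: divide_simps mult.commute)
    moreover have "lam1 + M * gam1 < 1" "lam2 + M * gam2 < 1"
      using M_bounds(2) gam1 gam2 by (auto simp: pos_less_divide_eq)
    ultimately show ?thesis unfolding lam using L by simp
  qed
  have gam_ge: "1 + M * beta \<le> gam"
  proof -
    have "M * beta \<le> M * (\<bar>k1 + k2\<bar> + \<bar>r\<bar>)"
      using M0 beta by (intro mult_left_mono) auto
    then show ?thesis by (simp add: gam algebra_simps)
  qed
  have gam_nonneg: "0 \<le> gam" using gam M0 by simp

  \<comment> \<open>One-step estimate for the Lyapunov function\<close>
  have step: "V (Suc t) \<le> lam * V t + gam * \<bar>v t - vs\<bar>" for t
  proof -
    define F where "F = f (d t) (x t)"
    define P where "P = sat bmin bmax (us + r * X t)"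
    have uP: "\<bar>u t - P\<bar> \<le> \<bar>z t\<bar>"
      unfolding u_sat P_def by (rule sat_lipschitz)
    have VS: "V (Suc t) = asym_norm q (X (Suc t))
        + M * \<bar>u t + k1 * X t - beta * X (Suc t) - us\<bar>"
      unfolding V_def zS ..
    have norm_nonneg: "0 \<le> asym_norm q (X t)"
      using q by (cases "X t \<ge> 0") (auto simp: asym_norm_def le_max_iff_disj mult_nonneg_nonpos)
    show ?thesis
    proof (cases "x t \<le> a - vs - u t")
      case True
      \<comment> \<open>The effective disturbance once the minimum is absorbed. In this case the
        cut-off a - x - u is at least vs, so clipping never moves v away from vs.\<close>
      define v' where "v' = min (v t) (a - x t - u t)"
      have XS: "X (Suc t) = X t - F + (u t + v')"
        unfolding X_def xS F_def v'_def by auto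
      have v': "\<bar>v' - vs\<bar> \<le> \<bar>v t - vs\<bar>"
        using True unfolding v'_def by auto
      have dom: "x t \<le> a - vs - bmin" "0 \<le> x t"
        using True u_range[of t] x_range[of t] by auto
      \<comment> \<open>The pair is (lam1, gam1) above the equilibrium and (lam2, gam2) below it;
        both sides then share one application of \<open>unsaturated_step\<close>.\<close>
      have "\<exists>l g. X t + (P - F + vs) \<le> l * asym_norm q (X t) \<and>
          q * (- (X t + (P - F + vs))) \<le> l * asym_norm q (X t) \<and>
          \<bar>(1 - beta) * P + beta * F - beta * vs - (beta - k1) * X t - us\<bar> \<le> g * asym_norm q (X t) \<and>
          l + M * g \<le> lam"
      proof (cases "xs \<le> x t")
        case True
        then have X0: "0 \<le> X t" by (simp add: X_def)
        then have G: "asym_norm q (X t) = X t"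
          using q by (simp add: asym_norm_def) (smt (verit) mult_nonneg_nonneg)
        have c: "- (lam1 * inverse q + 1) * X t \<le> P - F + vs" "P - F + vs \<le> (lam1 - 1) * X t"
          using cond_c dD[of t] True dom unfolding X_def P_def F_def by auto
        \<comment> \<open>A step from above to below xs is weighted by q, which cancels the
          \<open>inverse q\<close> in (c).\<close>
        have "q * (- (X t + (P - F + vs))) \<le> q * (lam1 * inverse q * X t)"
          using c(1) q by (intro mult_left_mono) (auto simp: algebra_simps)
        also have "\<dots> = lam1 * X t" using q by simp
        finally have "q * (- (X t + (P - F + vs))) \<le> lam1 * asym_norm q (X t)" by (simp add: G)
        moreover have "X t + (P - F + vs) \<le> lam1 * asym_norm q (X t)"
          using c(2) by (simp add: G algebra_simps)
        moreover have "\<bar>(1 - beta) * P + beta * F - beta * vs - (beta - k1) * X t - us\<bar>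
            \<le> gam1 * asym_norm q (X t)"
          using cond_d dD[of t] True dom unfolding G unfolding X_def P_def F_def by auto
        ultimately show ?thesis using lam_ge(3) by blast
      next
        case False
        then have X0: "X t \<le> 0" by (simp add: X_def)
        then have G: "asym_norm q (X t) = q * (- X t)"
          using q by (simp add: asym_norm_def) (smt (verit) mult_nonneg_nonpos)
        have c: "(lam2 - 1) * X t \<le> P - F + vs" "P - F + vs \<le> - (lam2 * q + 1) * X t"
          using cond_e dD[of t] False dom unfolding X_def P_def F_def by auto
        have "q * (- (X t + (P - F + vs))) \<le> q * (- (lam2 * X t))"
          using c(1) q by (intro mult_left_mono) (auto simp: algebra_simps)
        then have "q * (- (X t + (P - F + vs))) \<le> lam2 * asym_norm q (X t)"
          by (simp add: G algebra_simps)
        \<comment> \<open>Here a step from below to above xs has weight 1 but is compared with q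
          |X|, hence the factor q in (e).\<close>
        moreover have "X t + (P - F + vs) \<le> lam2 * asym_norm q (X t)"
          using c(2) by (simp add: G algebra_simps)
        moreover have "\<bar>(1 - beta) * P + beta * F - beta * vs - (beta - k1) * X t - us\<bar>
            \<le> gam2 * q * \<bar>X t\<bar>"
          using cond_f dD[of t] False dom unfolding X_def P_def F_def by auto
        ultimately show ?thesis using lam_ge(4) X0 by (auto simp: G mult.assoc)
      qed
      then obtain l g where lg: "X t + (P - F + vs) \<le> l * asym_norm q (X t)"
          "q * (- (X t + (P - F + vs))) \<le> l * asym_norm q (X t)"
          "\<bar>(1 - beta) * P + beta * F - beta * vs - (beta - k1) * X t - us\<bar> \<le> g * asym_norm q (X t)"
          "l + M * g \<le> lam"
        by blast
      have "V (Suc t) \<le> (l + M * g) * asym_norm q (X t)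
          + (inverse M + \<bar>1 - beta\<bar>) * (M * \<bar>z t\<bar>) + (1 + M * beta) * \<bar>v' - vs\<bar>"
        unfolding VS XS by (rule unsaturated_step[OF q M0 beta(2) lg(1-3) uP])
      also have "\<dots> \<le> lam * asym_norm q (X t) + lam * (M * \<bar>z t\<bar>) + gam * \<bar>v t - vs\<bar>"
        using lg(4) lam_ge(1) gam_ge gam_nonneg v' M0 norm_nonneg
        by (intro add_mono mult_right_mono mult_mono) auto
      finally show ?thesis by (simp add: V_def algebra_simps)
    next
      case False
      \<comment> \<open>\<open>e\<close> is nonzero only if the inputs fail to fill the capacity.
        The shortfall is then a - x - u - v, which is less than vs - v because a - x - u < vs in
        this case.\<close>
      define e where "e = min (u t + v t) (a - x t) - (a - x t)"
      have XS: "X (Suc t) = - (F + xs - a) + e"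
        unfolding X_def xS F_def e_def by simp
      have e: "\<bar>e\<bar> \<le> \<bar>v t - vs\<bar>"
        using False unfolding e_def by auto
      have dom: "x t \<in> {a - vs - bmax..a}"
        using False u_range[of t] x_range[of t] by auto
      \<comment> \<open>Here x exceeds xs by at least a - vs - xs - bmax > 0. Since bmin < us, the
        bound on r makes r negative and steep enough that us + r X has dropped to bmin or
        below.\<close>
      have "P = bmin"
      proof -
        have pos: "0 < a - vs - xs - bmax" using room by simp
        then have r': "r * (a - vs - xs - bmax) \<le> bmin - us"
          using r by (simp add: pos_le_divide_eq)
        have "r \<le> 0"
          using r pos equil_range(2) by (smt (verit) divide_nonpos_pos greaterThanLessThan_iff)
        then have "r * X t \<le> r * (a - vs - xs - bmax)"
          using dom by (intro mult_left_mono_neg) (auto simp: X_def)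
        then show ?thesis using r' unfolding P_def sat_def by auto
      qed
      then have u_z: "u t - bmin \<le> \<bar>z t\<bar>" using uP by simp
      have ca: "- ((k1 + L * inverse M) / (beta + inverse M)) * X t
          + (L * bmin + us - (1 + L) * max bmin (a - vs - x t)) / (beta + inverse M) \<le> F + xs - a"
          "F + xs - a \<le> 0"
        using cond_a dD[of t] dom unfolding X_def F_def by blast+
      \<comment> \<open>In this case u dominates both entries of the maximum, and the term has a
        negative sign in (a), so u may replace it. Below, u \<le> bmax does the same for
        (b).\<close>
      have "(1 + L) * max bmin (a - vs - x t) \<le> (1 + L) * u t"
        using False u_range[of t] L by (intro mult_left_mono) auto
      then have "(L * bmin + us - (1 + L) * u t) / (beta + inverse M)
          \<le> (L * bmin + us - (1 + L) * max bmin (a - vs - x t)) / (beta + inverse M)"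
        using M0 beta by (intro divide_right_mono) auto
      then have lower: "- ((k1 + L * inverse M) / (beta + inverse M)) * X t
          + (L * bmin + us - (1 + L) * u t) / (beta + inverse M) \<le> F + xs - a"
        using ca(1) by linarith
      have "(F + xs - a) * (beta - inverse M)
          \<le> (L * inverse M - k1) * X t + us - L * bmin - (1 - L) * bmax"
        using cond_b dD[of t] dom unfolding X_def F_def by blast
      moreover have "(1 - L) * u t \<le> (1 - L) * bmax"
        using u_range[of t] L by (intro mult_left_mono) auto
      ultimately have upper: "(F + xs - a) * (beta - inverse M)
          \<le> (L * inverse M - k1) * X t + us - L * bmin - (1 - L) * u t"
        by linarith
      have "V (Suc t) \<le> L * V t + (1 + M * beta) * \<bar>e\<bar>"
        unfolding VS XS unfolding V_def
        by (rule saturated_step[OF q M0 beta(2) L(1) ca(2) lower upper u_z])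
      also have "\<dots> \<le> lam * V t + gam * \<bar>v t - vs\<bar>"
        using lam_ge(2) gam_ge gam_nonneg e norm_nonneg M0
        by (intro add_mono mult_right_mono mult_mono) (auto simp: V_def)
      finally show ?thesis .
    qed
  qed

  \<comment> \<open>The Lyapunov function at time 0\<close>
  have V0: "V 0 \<le> M * (1 + \<bar>r\<bar> + \<bar>k1\<bar> + \<bar>k2\<bar>) * (\<bar>x 0 - xs\<bar> + \<bar>y 0 - xs\<bar> + \<bar>w 0 - us\<bar>)"
  proof -
    define A B C where "A = \<bar>x 0 - xs\<bar>" and "B = \<bar>y 0 - xs\<bar>" and "C = \<bar>w 0 - us\<bar>"
    have nonneg: "0 \<le> A" "0 \<le> B" "0 \<le> C" by (auto simp: A_def B_def C_def)
    \<comment> \<open>Writing x - y as (x - xs) - (y - xs) expresses z through the three initial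
      deviations.\<close>
    have "z 0 = (w 0 - us) - k1 * (x 0 - xs) + k1 * (y 0 - xs) - k2 * (x 0 - xs) - r * (x 0 - xs)"
      unfolding z_def s_def X_def by (simp add: algebra_simps)
    also have "\<bar>\<dots>\<bar> \<le> C + \<bar>k1\<bar> * A + \<bar>k1\<bar> * B + \<bar>k2\<bar> * A + \<bar>r\<bar> * A"
      unfolding A_def B_def C_def abs_mult[symmetric] by linarith
    finally have "M * \<bar>z 0\<bar> \<le> M * (C + \<bar>k1\<bar> * A + \<bar>k1\<bar> * B + \<bar>k2\<bar> * A + \<bar>r\<bar> * A)"
      using M0 by (intro mult_left_mono) auto
    moreover have "asym_norm q (X 0) \<le> M * A"
    proof -
      have "asym_norm q (X 0) \<le> A" using asym_norm_le_abs[OF q] by (simp add: X_def A_def)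
      moreover have "1 * A \<le> M * A" using M nonneg by (intro mult_right_mono) auto
      ultimately show ?thesis by simp
    qed
    ultimately have "V 0 \<le> M * (A + C + \<bar>k1\<bar> * A + \<bar>k1\<bar> * B + \<bar>k2\<bar> * A + \<bar>r\<bar> * A)"
      unfolding V_def by (simp add: algebra_simps)
    also have "\<dots> \<le> M * ((1 + \<bar>r\<bar> + \<bar>k1\<bar> + \<bar>k2\<bar>) * (A + B + C))"
    proof (intro mult_left_mono)
      have "(1 + \<bar>r\<bar> + \<bar>k1\<bar> + \<bar>k2\<bar>) * (A + B + C)
          - (A + C + \<bar>k1\<bar> * A + \<bar>k1\<bar> * B + \<bar>k2\<bar> * A + \<bar>r\<bar> * A)
          = B + \<bar>r\<bar> * (B + C) + \<bar>k1\<bar> * C + \<bar>k2\<bar> * (B + C)"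
        by (simp add: algebra_simps)
      also have "\<dots> \<ge> 0" using nonneg by simp
      finally show "A + C + \<bar>k1\<bar> * A + \<bar>k1\<bar> * B + \<bar>k2\<bar> * A + \<bar>r\<bar> * A
          \<le> (1 + \<bar>r\<bar> + \<bar>k1\<bar> + \<bar>k2\<bar>) * (A + B + C)" by simp
    qed (use M0 in simp)
    finally show ?thesis by (simp add: A_def B_def C_def mult.assoc)
  qed

  \<comment> \<open>Iteration of the one-step estimate\<close>
  show ?thesis
  proof (intro allI impI)
    fix t :: nat
    assume t: "1 \<le> t"
    define N where "N = Max ((\<lambda>i. \<bar>v i - vs\<bar>) ` {0..t - 1})"
    \<comment> \<open>For t \<ge> 1 the range \<open>{0..t - 1}\<close> consists exactly of the i <
      t and is nonempty, so \<open>N\<close> is a genuine maximum and is nonnegative.\<close>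
    have N: "\<bar>v i - vs\<bar> \<le> N" if "i < t" for i
      unfolding N_def using that by (intro Max_ge) auto
    have "0 \<le> N" using N[of 0] t by simp
    have "max (q * (xs - x t)) (x t - xs) \<le> V t"
      using M0 by (auto simp: V_def asym_norm_def X_def)
    also have "V t \<le> lam ^ t * V 0 + gam / (1 - lam) * N"
      using lam_nonneg lam_less gam_nonneg step N \<open>0 \<le> N\<close> by (rule linear_recursion_bound)
    also have "lam ^ t * V 0 \<le> lam ^ t * (M * (1 + \<bar>r\<bar> + \<bar>k1\<bar> + \<bar>k2\<bar>)
        * (\<bar>x 0 - xs\<bar> + \<bar>y 0 - xs\<bar> + \<bar>w 0 - us\<bar>))"
      using V0 lam_nonneg by (intro mult_left_mono) auto
    finally show "max (q * (xs - x t)) (x t - xs)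
      \<le> lam ^ t * M * (1 + \<bar>r\<bar> + \<bar>k1\<bar> + \<bar>k2\<bar>)
            * (\<bar>x 0 - xs\<bar> + \<bar>y 0 - xs\<bar> + \<bar>w 0 - us\<bar>)
          + gam / (1 - lam) * Max ((\<lambda>i. \<bar>v i - vs\<bar>) ` {0..t - 1})"
      by (simp add: N_def mult.assoc)
  qed
qed

end
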